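(* Let $d\ge2$ be an integer and $0<\delta<1$. Define \[ A_{d,\delta}=d(1-\delta)(1-\delta^{d-1}),\qquad R_{d,\delta}=\frac{d-1}{6}\,\frac{(1-\delta)(1-\delta^{d-2})}{1-\delta^{d-1}} . \] Then \[ N_{[]}(d,\delta)\le d+\delta^{-d}\Bigl(1-\delta^d+\sqrt{2A_{d,\delta}\delta}+\delta(1+R_{d,\delta})\Bigr)^d, \] \[ N(d,\delta)\le \delta^{-d}\Bigl(1-\delta^d+2\sqrt{A_{d,\delta}\delta}+2\delta(1+R_{d,\delta})\Bigr)^d . \] For fixed $d$, both right-hand sides are $\delta^{-d}\bigl(1+O_d(\sqrt\delta)\bigr)$ as $\delta\downarrow0$.
   Context: For $\boldsymbol x\in[0,1]^d$ put $V(\boldsymbol x)=\prod_{j=1}^d x_j$; $\boldsymbol x\le\boldsymbol y$ is coordinatewise. If $\boldsymbol x\le\boldsymbol y$ in $[0,1]^d$, the box $[\boldsymbol x,\boldsymbol y]$ is a $\delta$-bracket when $V(\boldsymbol y)-V(\boldsymbol x)\le\delta$. A $\delta$-bracketing cover is a finite family of $\delta$-brackets whose union is $[0,1]^d$; $N_{[]}(d,\delta)$ is its minimum possible cardinality. A finite set $\Gamma\subset[0,1]^d$ is a $\delta$-cover if for every $\boldsymbol z\in[0,1]^d$ there are $\boldsymbol x,\boldsymbol y\in\Gamma\cup\{\boldsymbol 0\}$ with $\boldsymbol x\le\boldsymbol z\le\boldsymbol y$ and $V(\boldsymbol y)-V(\boldsymbol x)\le\delta$; $N(d,\delta)$ is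 the minimum cardinality $|\Gamma|$ of a $\delta$-cover. $O_d(\cdot)$ means that the implied constant may depend on $d$. *)

theory Defs
  imports "HOL-Analysis.Analysis" "HOL-Library.Landau_Symbols"
begin

text \<open>The unit cube of dimension d is \<open>{0..1} :: (real ^ 'n) set\<close> with \<open>CARD('n) = d\<close>; the order
  on \<open>real ^ 'n\<close> is coordinatewise, \<open>1\<close> is the all-ones vector, and \<open>{x..y}\<close> is the closed box.\<close>

text \<open>For \<open>x\<close> in the unit cube, \<open>vol0 x\<close> is the volume of \<open>{0..x}\<close>.\<close>

definition vol0 :: "real ^ 'n::finite \<Rightarrow> real" where
  "vol0 x = (\<Prod>j\<in>UNIV. x $ j)"

definition is_bracket :: "real \<Rightarrow> (real ^ 'n::finite) set \<Rightarrow> bool" where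
  "is_bracket \<delta> B \<longleftrightarrow>
     (\<exists>x\<in>{0..1}. \<exists>y\<in>{0..1}. x \<le> y \<and> B = {x..y} \<and> vol0 y - vol0 x \<le> \<delta>)"

definition is_bracketing_cover :: "real \<Rightarrow> (real ^ 'n::finite) set set \<Rightarrow> bool" where
  "is_bracketing_cover \<delta> \<B> \<longleftrightarrow>
     finite \<B> \<and> (\<forall>B\<in>\<B>. is_bracket \<delta> B) \<and> \<Union>\<B> = {0..1}"

definition is_delta_cover :: "real \<Rightarrow> (real ^ 'n::finite) set \<Rightarrow> bool" where
  "is_delta_cover \<delta> \<Gamma> \<longleftrightarrow>
     finite \<Gamma> \<and> \<Gamma> \<subseteq> {0..1} \<and>
     (\<forall>z\<in>{0..1}. \<exists>x\<in>\<Gamma> \<union> {0}. \<exists>y\<in>\<Gamma> \<union> {0}. x \<le> z \<and> z \<le> y \<and> vol0 y - vol0 x \<le> \<delta>)"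

text \<open>The minimum cardinalities are infima in \<open>enat\<close>: these are attained as soon as a cover exists,
  and are \<open>\<infinity>\<close> otherwise, so that a finite upper bound also asserts existence of a cover.
  The dimension is passed as the index type.\<close>

definition bracketing_number :: "'n::finite itself \<Rightarrow> real \<Rightarrow> enat" where
  "bracketing_number _ \<delta> =
     (INF \<B> \<in> {\<B> :: (real ^ 'n) set set. is_bracketing_cover \<delta> \<B>}. enat (card \<B>))"

definition covering_number :: "'n::finite itself \<Rightarrow> real \<Rightarrow> enat" where
  "covering_number _ \<delta> =
     (INF \<Gamma> \<in> {\<Gamma> :: (real ^ 'n) set. is_delta_cover \<delta> \<Gamma>}. enat (card \<Gamma>))"

text \<open>The natural-number exponents \<open>d - 1\<close> and \<open>d - 2\<close> are only meant for \<open>d \<ge> 2\<close>.\<close>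

definition A_coeff :: "nat \<Rightarrow> real \<Rightarrow> real" where
  "A_coeff d \<delta> = real d * (1 - \<delta>) * (1 - \<delta> ^ (d - 1))"

definition R_coeff :: "nat \<Rightarrow> real \<Rightarrow> real" where
  "R_coeff d \<delta> = (real d - 1) / 6 * ((1 - \<delta>) * (1 - \<delta> ^ (d - 2)) / (1 - \<delta> ^ (d - 1)))"

definition bracketing_bound :: "nat \<Rightarrow> real \<Rightarrow> real" where
  "bracketing_bound d \<delta> =
     real d + \<delta> powi (- int d) *
       (1 - \<delta> ^ d + sqrt (2 * A_coeff d \<delta> * \<delta>) + \<delta> * (1 + R_coeff d \<delta>)) ^ d"

definition covering_bound :: "nat \<Rightarrow> real \<Rightarrow> real" where
  "covering_bound d \<delta> =
     \<delta> powi (- int d) *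
       (1 - \<delta> ^ d + 2 * sqrt (A_coeff d \<delta> * \<delta>) + 2 * \<delta> * (1 + R_coeff d \<delta>)) ^ d"

end

theory Submission
  imports Defs
begin

text \<open>
  Both covers come from a grid whose mesh width is adapted to the gradient of the volume
  function.  At a point \<open>y\<close> the volume has the partial derivatives \<open>(\<Prod>k\<in>UNIV - {j}. y $ k)\<close>, so a small
  box with top vertex \<open>y\<close> is a \<open>\<delta>\<close>-bracket as soon as its side in direction \<open>j\<close> has length at most
  \<open>\<delta> / d\<close> divided by this cofactor.  Boxes of this shape have volume
  \<open>(\<delta> / d) ^ d / (\<Prod>k\<in>UNIV. y $ k) ^ (d - 1)\<close>, and the number of
  them that fills the cube is about the integral of the reciprocal of that, which is
  \<open>\<delta> powi (- d)\<close>, the leading term.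

  To make this precise, put aside the points with a coordinate at most \<open>\<delta>\<close>, which lie in \<open>d\<close>
  brackets with lower vertex \<open>0\<close>.  Cut the remaining cube with sides \<open>[\<delta>, 1]\<close> into \<open>m ^ d\<close> congruent
  blocks, and divide each block uniformly with the cofactors of its top vertex.  The cells obtained in
  this way are \<open>\<delta>\<close>-brackets (\<open>cell_is_bracket\<close>), and their vertices form a \<open>\<delta>\<close>-cover.  The
  number of pieces in direction \<open>j\<close> is at most \<open>1 + c * cofactor\<close> with
  \<open>c = d * (1 - \<delta>) / (m * \<delta>)\<close>, and one more for vertices.

  The cofactors mix the coordinates, and so the sum over all blocks of the products of these numbers
  is not a product.  A consequence of Hoelder's inequality (\<open>prod_cofactors_le_prod_powers\<close>)
  permits to replace, in the product over \<open>j\<close>, the cofactor by the \<open>(d - 1)\<close>-st power of the \<open>j\<close>-th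
  coordinate alone.  Then the sum over the blocks factors and is the \<open>d\<close>-th power of a
  one-dimensional sum (\<open>sum_blocks_le_power\<close>), in essence a Riemann sum of
  \<open>d * x ^ (d - 1) / \<delta>\<close> over \<open>[\<delta>, 1]\<close>.  It is evaluated by the trapezoidal rule with an explicit error
  (\<open>right_endpoint_rule_power\<close>).  A larger \<open>m\<close> makes the Riemann sum more accurate but
  increases the cost of rounding; balancing the two (\<open>optimal_mesh\<close>) produces the square root.
\<close>

section \<open>Inequalities for products\<close>

text \<open>A form of Hoelder's inequality (superadditivity of the geometric mean).  With \<open>P k = w + c * y k ^ r\<close>
  and \<open>G\<close> the product of the \<open>P k\<close>, the AM-GM inequality bounds the geometric means of the
  \<open>w / P k\<close> and of the \<open>c * y k ^ r / P k\<close> by arithmetic means; these add up to \<open>1\<close>, and the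
  geometric means are \<open>w\<close> and \<open>c * (\<Prod>k\<in>S. y k)\<close>, each divided by the \<open>r\<close>-th root of \<open>G\<close>.\<close>

lemma huygens_inequality:
  fixes y :: "'a \<Rightarrow> real"
  assumes fin: "finite S" "S \<noteq> {}" and w: "w > 0" and c: "c \<ge> 0"
    and y: "\<And>k. k \<in> S \<Longrightarrow> 0 \<le> y k"
  shows "(w + c * (\<Prod>k\<in>S. y k)) ^ card S \<le> (\<Prod>k\<in>S. w + c * y k ^ card S)"
proof -
  define r where "r = card S"
  define P where "P k = w + c * y k ^ r" for k
  define G where "G = (\<Prod>k\<in>S. P k)"
  have r: "r > 0"
    using fin by (simp add: r_def card_gt_0_iff)
  have P: "P k > 0" if "k \<in> S" for k
    using w c y[OF that] unfolding P_def by (intro add_pos_nonneg) auto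
  have G: "G > 0"
    unfolding G_def by (intro prod_pos) (use P in auto)
  have root: "(x ^ r) powr (1 / r) = x" if "x \<ge> 0" for x :: real
    using that r by (cases "x = 0") (auto simp: powr_powr simp flip: powr_realpow)
  have am_gm: "u / G powr (1 / r) \<le> (\<Sum>k\<in>S. v k / P k / r)"
    if "u \<ge> 0" "(\<Prod>k\<in>S. v k) = u ^ r" "\<And>k. k \<in> S \<Longrightarrow> v k \<ge> 0" for u v
  proof -
    have "u / G powr (1 / r) = (u ^ r / G) powr (1 / r)"
      using that G by (simp add: powr_divide root)
    also have "u ^ r / G = (\<Prod>k\<in>S. v k / P k)"
      by (simp add: that(2) G_def prod_dividef)
    also have "\<dots> powr (1 / r) \<le> (\<Sum>k\<in>S. v k / P k / r)"
      unfolding r_def using that P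
      by (intro arith_geom_mean fin divide_nonneg_nonneg) (auto intro: less_imp_le)
    finally show ?thesis .
  qed
  have 1: "w / G powr (1 / r) \<le> (\<Sum>k\<in>S. w / P k / r)"
    using w by (intro am_gm) (auto simp: r_def)
  have 2: "c * (\<Prod>k\<in>S. y k) / G powr (1 / r) \<le> (\<Sum>k\<in>S. c * y k ^ r / P k / r)"
    using c y
    by (intro am_gm)
       (auto simp: r_def prod.distrib power_mult_distrib prod_power_distrib prod_nonneg)
  have "(w + c * (\<Prod>k\<in>S. y k)) / G powr (1 / r)
      \<le> (\<Sum>k\<in>S. w / P k / r + c * y k ^ r / P k / r)"
    using 1 2 by (simp add: add_divide_distrib sum.distrib)
  also have "\<dots> = (\<Sum>k\<in>S. 1 / r)"
  proof (intro sum.cong refl)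
    fix k assume "k \<in> S"
    then show "w / P k / r + c * y k ^ r / P k / r = 1 / r"
      using P[of k] by (simp add: P_def flip: add_divide_distrib)
  qed
  also have "\<dots> = 1"
    using r by (simp add: r_def)
  finally have "w + c * (\<Prod>k\<in>S. y k) \<le> G powr (1 / r)"
    using G by (simp add: field_simps)
  then have "(w + c * (\<Prod>k\<in>S. y k)) ^ r \<le> (G powr (1 / r)) ^ r"
    using w c y by (intro power_mono add_nonneg_nonneg mult_nonneg_nonneg prod_nonneg) auto
  also have "\<dots> = G"
    using G r by (simp add: powr_powr flip: powr_realpow)
  finally show ?thesis
    by (simp add: r_def G_def P_def)
qed

text \<open>This inequality decouples the coordinates.  The left-hand side will count the cells of one block,
  and each of its factors involves all coordinates of the block but one; on the right each factor
  involves a single coordinate, so that the sum over all blocks becomes a power of a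
  one-dimensional sum.  To prove it, take \<open>huygens_inequality\<close> on each \<open>S - {j}\<close> and multiply over
  \<open>j\<close>: every factor of the right-hand side then occurs \<open>r\<close> times.\<close>

lemma prod_cofactors_le_prod_powers:
  fixes y :: "'a \<Rightarrow> real"
  assumes fin: "finite S" and card: "card S = Suc r" "r > 0" and w: "w > 0" and c: "c \<ge> 0"
    and y: "\<And>k. k \<in> S \<Longrightarrow> 0 \<le> y k"
  shows "(\<Prod>j\<in>S. w + c * (\<Prod>k\<in>S - {j}. y k)) \<le> (\<Prod>j\<in>S. w + c * y j ^ r)"
proof -
  define P where "P k = w + c * y k ^ r" for k
  define G where "G = (\<Prod>k\<in>S. P k)"
  have P: "P k > 0" if "k \<in> S" for k
    using w c y[OF that] unfolding P_def by (intro add_pos_nonneg) auto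
  have G: "G > 0"
    unfolding G_def by (intro prod_pos) (use P in auto)
  have "(\<Prod>j\<in>S. w + c * (\<Prod>k\<in>S - {j}. y k)) ^ r
      = (\<Prod>j\<in>S. (w + c * (\<Prod>k\<in>S - {j}. y k)) ^ r)"
    by (rule prod_power_distrib)
  also have "\<dots> \<le> (\<Prod>j\<in>S. \<Prod>k\<in>S - {j}. P k)"
  proof (intro prod_mono conjI)
    fix j assume j: "j \<in> S"
    then have "card (S - {j}) = r"
      using card fin by simp
    moreover from this have "S - {j} \<noteq> {}"
      using card(2) by (metis card.empty less_irrefl)
    ultimately show "(w + c * (\<Prod>k\<in>S - {j}. y k)) ^ r \<le> (\<Prod>k\<in>S - {j}. P k)"
      using huygens_inequality[of "S - {j}" w c y] fin w c y unfolding P_def by auto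
    show "0 \<le> (w + c * (\<Prod>k\<in>S - {j}. y k)) ^ r"
      using w c y by (intro zero_le_power add_nonneg_nonneg mult_nonneg_nonneg prod_nonneg) auto
  qed
  also have "\<dots> = (\<Prod>j\<in>S. G / P j)"
    using P fin by (intro prod.cong refl) (simp add: G_def prod.remove nonzero_eq_divide_eq
        mult.commute less_imp_neq[THEN not_sym])
  also have "\<dots> = G ^ r"
    using G card by (simp add: prod_dividef flip: G_def)
  finally show ?thesis
    unfolding G_def P_def using card(2) G
    by (subst (asm) power_mono_iff)
       (auto simp: G_def P_def intro!: prod_nonneg add_nonneg_nonneg mult_nonneg_nonneg y c
          less_imp_le[OF w])
qed

text \<open>The slabs between the boxes \<open>[0, x]\<close> and \<open>[0, y]\<close>, one for each coordinate direction, cover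
  their difference.\<close>

lemma prod_diff_le_sum_cofactors:
  fixes x y :: "'a \<Rightarrow> real"
  assumes "finite S" and xy: "\<And>k. k \<in> S \<Longrightarrow> 0 \<le> x k \<and> x k \<le> y k"
  shows "(\<Prod>k\<in>S. y k) - (\<Prod>k\<in>S. x k) \<le> (\<Sum>j\<in>S. (\<Prod>k\<in>S - {j}. y k) * (y j - x j))"
  using assms
proof (induction S rule: finite_induct)
  case (insert j S)
  let ?Y = "\<Prod>k\<in>S. y k" and ?X = "\<Prod>k\<in>S. x k"
  have yj: "0 \<le> y j"
    using insert.prems[of j] by (meson insertI1 order_trans)
  have "?X \<le> ?Y"
    using insert.prems by (intro prod_mono) auto
  then have "x j * (?Y - ?X) \<le> y j * (?Y - ?X)"
    using insert.prems[of j] by (intro mult_right_mono) auto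
  then have "y j * ?Y - x j * ?X \<le> ?Y * (y j - x j) + y j * (?Y - ?X)"
    by (simp add: algebra_simps)
  also have "y j * (?Y - ?X) \<le> y j * (\<Sum>i\<in>S. (\<Prod>k\<in>S - {i}. y k) * (y i - x i))"
    using yj insert.prems by (intro mult_left_mono insert.IH) auto
  also have "\<dots> = (\<Sum>i\<in>S. (\<Prod>k\<in>insert j S - {i}. y k) * (y i - x i))"
    unfolding sum_distrib_left
  proof (intro sum.cong refl)
    fix i assume "i \<in> S"
    then have "insert j S - {i} = insert j (S - {i})"
      using insert.hyps by auto
    then show "y j * ((\<Prod>k\<in>S - {i}. y k) * (y i - x i)) = (\<Prod>k\<in>insert j S - {i}. y k) * (y i - x i)"
      using insert.hyps by simp
  qed
  finally show ?case
    using insert.hyps by simp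
qed simp

section \<open>The right endpoint rule for powers\<close>

lemma sum_binomial_terms_times_index:
  fixes a h :: real
  shows "(\<Sum>k\<le>Suc n. real k * (real (Suc n choose k) * h ^ k * a ^ (Suc n - k)))
       = real (Suc n) * h * (h + a) ^ n"
proof -
  have "real (Suc k) * (real (Suc n choose Suc k) * h ^ Suc k * a ^ (Suc n - Suc k))
      = real (Suc n) * h * (real (n choose k) * h ^ k * a ^ (n - k))" for k
  proof -
    have "real (Suc k) * real (Suc n choose Suc k) = real (Suc n) * real (n choose k)"
      using Suc_times_binomial[of k n] by (metis of_nat_mult)
    then show ?thesis
      by (simp add: mult_ac del: binomial_Suc_Suc of_nat_Suc)
  qed
  then show ?thesis
    unfolding sum.atMost_Suc_shift binomial_ring[of h a n] sum_distrib_left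
    by (simp only: of_nat_0 mult_zero_left add_0)
qed

lemma sum_binomial_terms_times_index2:
  fixes a h :: real
  shows "(\<Sum>k\<le>n + 2. real k * (real k - 1) * (real (n + 2 choose k) * h ^ k * a ^ (n + 2 - k)))
       = real (n + 2) * real (n + 1) * h\<^sup>2 * (h + a) ^ n"
proof -
  have "real (Suc k) * (real (Suc k) - 1) *
          (real (n + 2 choose Suc k) * h ^ Suc k * a ^ (n + 2 - Suc k))
      = real (n + 2) * h * (real k * (real (Suc n choose k) * h ^ k * a ^ (Suc n - k)))" for k
  proof -
    have "real (Suc k) * real (n + 2 choose Suc k) = real (n + 2) * real (Suc n choose k)"
      using Suc_times_binomial[of k "Suc n"] by (metis of_nat_mult add_2_eq_Suc')
    then have "(real k * h ^ Suc k * a ^ (Suc n - k)) * (real (Suc k) * real (n + 2 choose Suc k))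
       = (real k * h ^ Suc k * a ^ (Suc n - k)) * (real (n + 2) * real (Suc n choose k))"
      by simp
    then show ?thesis
      by (simp add: mult_ac del: binomial_Suc_Suc)
  qed
  then have "(\<Sum>k\<le>Suc (Suc n). real k * (real k - 1) *
        (real (n + 2 choose k) * h ^ k * a ^ (n + 2 - k)))
     = real (n + 2) * h * (\<Sum>k\<le>Suc n. real k * (real (Suc n choose k) * h ^ k * a ^ (Suc n - k)))"
    unfolding sum.atMost_Suc_shift[of _ "Suc n"] sum_distrib_left
    by (simp only: of_nat_0 mult_zero_left add_0)
  then show ?thesis
    unfolding sum_binomial_terms_times_index by (simp add: power2_eq_square)
qed

text \<open>The trapezoidal rule for \<open>x ^ (d - 1)\<close> on an interval, with the end correction of the
  Euler-Maclaurin formula as error bound.  The form with differences on the right makes the sum over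
  adjacent intervals telescope.

  Expand in powers of \<open>h\<close>.  After the terms at \<open>a + h\<close> and those at \<open>a\<close> are collected on different
  sides, the side at \<open>a + h\<close> has the coefficients
  \<open>(d choose k) * (1 - k / 2 + k * (k - 1) / 12) = (d choose k) * (k - 3) * (k - 4) / 12\<close>.
  These are never negative for integral \<open>k\<close>, and the terms with \<open>k \<le> 2\<close> are exactly the side at \<open>a\<close>.\<close>

lemma right_endpoint_rule_power:
  fixes a h :: real
  assumes "a \<ge> 0" "h \<ge> 0" "d \<ge> 2"
  shows "h * real d * (a + h) ^ (d - 1)
       \<le> ((a + h) ^ d - a ^ d) + h / 2 * real d * ((a + h) ^ (d - 1) - a ^ (d - 1))
         + h\<^sup>2 / 12 * real d * (real d - 1) * ((a + h) ^ (d - 2) - a ^ (d - 2))"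
proof -
  obtain n where d: "d = n + 2"
    using assms(3) by (metis le_add_diff_inverse2)
  define T where "T k = real (d choose k) * h ^ k * a ^ (d - k)" for k
  define W where "W k = (real k - 3) * (real k - 4) / 12" for k :: nat
  have W: "W k \<ge> 0" for k
    by (cases "k \<le> 3") (auto simp: W_def mult_nonpos_nonpos mult_nonneg_nonneg)
  have choose2: "real (d choose 2) = (real n + 2) * (real n + 1) / 2"
    unfolding d numeral_2_eq_2 by (induction n) (auto simp: field_simps)
  have T: "T 0 = a ^ d" "T 1 = real d * h * a ^ (d - 1)"
    "T 2 = (real n + 2) * (real n + 1) / 2 * h\<^sup>2 * a ^ (d - 2)"
    by (simp_all add: T_def choose2)
  have "a ^ d + real d / 2 * h * a ^ (d - 1) + h\<^sup>2 / 12 * real d * (real d - 1) * a ^ (d - 2)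
     = (\<Sum>k\<le>2. W k * T k)"
    using T by (simp add: W_def d numeral_2_eq_2 field_simps)
  also have "\<dots> \<le> (\<Sum>k\<le>d. W k * T k)"
    using assms W by (intro sum_mono2) (auto simp: T_def)
  also have "\<dots> = (\<Sum>k\<le>d. T k) - 1 / 2 * (\<Sum>k\<le>d. real k * T k)
      + 1 / 12 * (\<Sum>k\<le>d. real k * (real k - 1) * T k)"
    unfolding sum_distrib_left sum_subtractf[symmetric] sum.distrib[symmetric]
    by (intro sum.cong refl) (simp add: W_def field_simps)
  also have "(\<Sum>k\<le>d. T k) = (a + h) ^ d"
    using binomial_ring[of h a d] by (simp add: T_def add.commute)
  also have "(\<Sum>k\<le>d. real k * T k) = real d * h * (a + h) ^ (d - 1)"
    using sum_binomial_terms_times_index[where n = "Suc n"] by (simp add: T_def d add.commute)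
  also have "(\<Sum>k\<le>d. real k * (real k - 1) * T k)
      = real d * (real d - 1) * h\<^sup>2 * (a + h) ^ (d - 2)"
    using sum_binomial_terms_times_index2[where n = n] by (simp add: T_def d add.commute)
  finally show ?thesis
    by (simp add: algebra_simps add_divide_distrib diff_divide_distrib)
qed

section \<open>The graded grid on the part of the cube away from the lower faces\<close>

definition node :: "real \<Rightarrow> real \<Rightarrow> nat \<Rightarrow> nat \<Rightarrow> real" where
  "node a b n l = a + real l * (b - a) / real n"

lemma node_0 [simp]: "node a b n 0 = a"
  by (simp add: node_def)

lemma node_last [simp]: "n > 0 \<Longrightarrow> node a b n n = b"
  by (simp add: node_def)

lemma node_Suc: "node a b n (Suc l) = node a b n l + (b - a) / real n"
  by (simp add: node_def distrib_right add_divide_distrib)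

lemma node_mono: "a \<le> b \<Longrightarrow> l \<le> l' \<Longrightarrow> node a b n l \<le> node a b n l'"
  by (auto simp: node_def intro!: divide_right_mono mult_right_mono)

lemma node_bounds:
  assumes "a \<le> b" "l \<le> n" "n > 0"
  shows "a \<le> node a b n l" "node a b n l \<le> b"
  using node_mono[of a b 0 l n] node_mono[of a b l n n] assms by auto

lemma between_nodes:
  assumes "n > 0" "a \<le> t" "t \<le> b"
  obtains l where "l < n" "node a b n l \<le> t" "t \<le> node a b n (Suc l)"
proof -
  \<comment> \<open>the last node at or below \<open>t\<close>, the right end of the interval excluded\<close>
  define l where "l = (GREATEST l. l < n \<and> node a b n l \<le> t)"
  have l: "l < n \<and> node a b n l \<le> t"
    unfolding l_def by (rule GreatestI_nat[where k = 0 and b = n]) (use assms in auto)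
  have "t \<le> node a b n (Suc l)"
  proof (cases "Suc l = n")
    case True
    with assms show ?thesis by simp
  next
    case False
    have "Suc l \<le> l" if "Suc l < n \<and> node a b n (Suc l) \<le> t"
      unfolding l_def by (rule Greatest_le_nat[where b = n]) (use that in \<open>auto simp: l_def\<close>)
    with False l show ?thesis by force
  qed
  with l that show ?thesis by blast
qed

text \<open>The cube \<open>{\<delta>..1} ^ d\<close> is cut into \<open>m ^ d\<close> congruent blocks; a block is represented by the function
  that gives the number of its interval in each coordinate direction.\<close>

definition blocks :: "nat \<Rightarrow> ('n::finite \<Rightarrow> nat) set" where
  "blocks m = PiE UNIV (\<lambda>_. {..<m})"

lemma mem_blocks: "i \<in> blocks m \<longleftrightarrow> (\<forall>j. i j < m)"
  by (auto simp: blocks_def)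

lemma finite_blocks [simp]: "finite (blocks m)"
  by (simp add: blocks_def finite_PiE)

text \<open>The partial derivative of the volume in direction \<open>j\<close> at the top vertex of the block \<open>i\<close>, which is
  its maximum over that block.\<close>

definition cofactor :: "real \<Rightarrow> nat \<Rightarrow> ('n::finite \<Rightarrow> nat) \<Rightarrow> 'n \<Rightarrow> real" where
  "cofactor \<delta> m i j = (\<Prod>k\<in>UNIV - {j}. node \<delta> 1 m (Suc (i k)))"

text \<open>Across a block, the volume grows in direction \<open>j\<close> by at most the cofactor times the side length
  \<open>(1 - \<delta>) / m\<close>.  Each of the \<open>d\<close> directions may use a share \<open>\<delta> / d\<close> of the tolerance, which
  determines the number of pieces into which this side has to be divided.\<close>

definition pieces_per_cofactor :: "nat \<Rightarrow> real \<Rightarrow> nat \<Rightarrow> real" where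
  "pieces_per_cofactor d \<delta> m = real d * ((1 - \<delta>) / real m) / \<delta>"

definition pieces :: "real \<Rightarrow> nat \<Rightarrow> ('n::finite \<Rightarrow> nat) \<Rightarrow> 'n \<Rightarrow> nat" where
  "pieces \<delta> m i j = nat \<lceil>pieces_per_cofactor CARD('n) \<delta> m * cofactor \<delta> m i j\<rceil>"

definition cell_vertex :: "real \<Rightarrow> nat \<Rightarrow> ('n::finite \<Rightarrow> nat) \<Rightarrow> ('n \<Rightarrow> nat) \<Rightarrow> real ^ 'n" where
  "cell_vertex \<delta> m i l =
     (\<chi> j. node (node \<delta> 1 m (i j)) (node \<delta> 1 m (Suc (i j))) (pieces \<delta> m i j) (l j))"

text \<open>The number \<open>w + c * cofactor \<delta> m i j\<close> stands for a bound on the number of cells (\<open>w = 1\<close>) or of grid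
  points (\<open>w = 2\<close>) along one side of a block.\<close>

lemma sum_blocks_le_power:
  fixes d :: nat
  assumes d: "d = CARD('n::finite)" "d \<ge> 2" and \<delta>: "0 < \<delta>" "\<delta> < 1" and w: "w > 0" and c: "c \<ge> 0"
  shows "(\<Sum>i\<in>blocks m. \<Prod>j\<in>(UNIV :: 'n set). w + c * cofactor \<delta> m i j)
     \<le> (\<Sum>l<m. w + c * node \<delta> 1 m (Suc l) ^ (d - 1)) ^ d"
proof -
  have "(\<Sum>i\<in>blocks m. \<Prod>j\<in>(UNIV :: 'n set). w + c * cofactor \<delta> m i j)
     \<le> (\<Sum>i\<in>blocks m. \<Prod>j\<in>(UNIV :: 'n set). w + c * node \<delta> 1 m (Suc (i j)) ^ (d - 1))"
    unfolding cofactor_def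
  proof (intro sum_mono prod_cofactors_le_prod_powers)
    show "card (UNIV :: 'n set) = Suc (d - 1)" "d - 1 > 0"
      using d by auto
    show "0 \<le> node \<delta> 1 m (Suc (i k))" for i :: "'n \<Rightarrow> nat" and k
      using \<delta> by (simp add: node_def)
  qed (use w c in auto)
  also have "\<dots> = (\<Prod>j\<in>(UNIV :: 'n set). \<Sum>l<m. w + c * node \<delta> 1 m (Suc l) ^ (d - 1))"
    unfolding blocks_def by (rule prod_sum_PiE[symmetric]) auto
  finally show ?thesis
    by (simp add: d)
qed

lemma vol0_diff_le_sum_cofactors:
  fixes x y Y :: "real ^ 'n::finite"
  assumes "0 \<le> x" "x \<le> y" "y \<le> Y"
  shows "vol0 y - vol0 x \<le> (\<Sum>j\<in>UNIV. (\<Prod>k\<in>UNIV - {j}. Y $ k) * (y $ j - x $ j))"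
proof -
  have *: "0 \<le> x $ k" "x $ k \<le> y $ k" "y $ k \<le> Y $ k" for k
    using assms by (auto simp: less_eq_vec_def)
  have **: "0 \<le> y $ k" for k
    using *(1,2)[of k] by linarith
  have "vol0 y - vol0 x \<le> (\<Sum>j\<in>UNIV. (\<Prod>k\<in>UNIV - {j}. y $ k) * (y $ j - x $ j))"
    unfolding vol0_def by (intro prod_diff_le_sum_cofactors) (use * in auto)
  also have "\<dots> \<le> (\<Sum>j\<in>UNIV. (\<Prod>k\<in>UNIV - {j}. Y $ k) * (y $ j - x $ j))"
    using * ** by (intro sum_mono mult_right_mono prod_mono) auto
  finally show ?thesis .
qed

context
  fixes \<delta> :: real and m :: nat
  assumes \<delta>: "0 < \<delta>" "\<delta> < 1" and m: "m > 0"
begin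

lemma block_node_bounds:
  assumes "i < m"
  shows "\<delta> \<le> node \<delta> 1 m i" "node \<delta> 1 m i \<le> node \<delta> 1 m (Suc i)" "node \<delta> 1 m (Suc i) \<le> 1"
  using node_bounds[of \<delta> 1 i m] node_bounds[of \<delta> 1 "Suc i" m] node_mono[of \<delta> 1 i "Suc i" m] assms \<delta> m
  by auto

lemma pieces_per_cofactor_nonneg: "pieces_per_cofactor d \<delta> m \<ge> 0"
  using \<delta> by (simp add: pieces_per_cofactor_def)

lemma cofactor_pos: "cofactor \<delta> m i j > 0"
  using \<delta> unfolding cofactor_def node_def by (intro prod_pos ballI add_pos_nonneg) auto

lemma pieces_bounds:
  fixes i :: "'n::finite \<Rightarrow> nat"
  shows "pieces \<delta> m i j > 0"
    and "pieces_per_cofactor CARD('n) \<delta> m * cofactor \<delta> m i j \<le> real (pieces \<delta> m i j)"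
    and "real (pieces \<delta> m i j) \<le> 1 + pieces_per_cofactor CARD('n) \<delta> m * cofactor \<delta> m i j"
proof -
  have "pieces_per_cofactor CARD('n) \<delta> m > 0"
    using \<delta> m by (simp add: pieces_per_cofactor_def)
  then have "pieces_per_cofactor CARD('n) \<delta> m * cofactor \<delta> m i j > 0"
    using cofactor_pos by (simp add: zero_less_mult_iff)
  then show "pieces \<delta> m i j > 0"
    and "pieces_per_cofactor CARD('n) \<delta> m * cofactor \<delta> m i j \<le> real (pieces \<delta> m i j)"
    and "real (pieces \<delta> m i j) \<le> 1 + pieces_per_cofactor CARD('n) \<delta> m * cofactor \<delta> m i j"
    unfolding pieces_def by linarith+
qed

lemma cell_vertex_bounds:
  assumes "i \<in> blocks m" "\<And>j. l j \<le> pieces \<delta> m i j"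
  shows "node \<delta> 1 m (i j) \<le> cell_vertex \<delta> m i l $ j"
    "cell_vertex \<delta> m i l $ j \<le> node \<delta> 1 m (Suc (i j))"
  using node_bounds[OF block_node_bounds(2) assms(2) pieces_bounds(1)] assms(1)
  by (auto simp: cell_vertex_def mem_blocks)

lemma cell_vertex_in_cube:
  assumes "i \<in> blocks m" "\<And>j. l j \<le> pieces \<delta> m i j"
  shows "cell_vertex \<delta> m i l \<in> {0..1}"
proof -
  have "0 \<le> cell_vertex \<delta> m i l $ j \<and> cell_vertex \<delta> m i l $ j \<le> 1" for j
    using cell_vertex_bounds[OF assms, of j] block_node_bounds[of "i j"] assms(1) \<delta>
    by (auto simp: mem_blocks)
  then show ?thesis
    by (simp add: less_eq_vec_def)
qed

text \<open>Moving from the bottom to the top of a cell, each of the \<open>d\<close> directions adds at most \<open>\<delta> / d\<close> to the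
  volume, by the choice of \<open>pieces\<close>.\<close>

lemma cell_is_bracket:
  fixes i :: "'n::finite \<Rightarrow> nat"
  assumes i: "i \<in> blocks m" and l: "\<And>j. l j < pieces \<delta> m i j"
  defines "x \<equiv> cell_vertex \<delta> m i l" and "y \<equiv> cell_vertex \<delta> m i (\<lambda>j. Suc (l j))"
  shows "x \<in> {0..1}" "y \<in> {0..1}" "x \<le> y" "vol0 y - vol0 x \<le> \<delta>"
proof -
  define Y :: "real ^ 'n" where "Y = (\<chi> j. node \<delta> 1 m (Suc (i j)))"
  have l': "l j \<le> pieces \<delta> m i j" "Suc (l j) \<le> pieces \<delta> m i j" for j
    using l[of j] by auto
  show x: "x \<in> {0..1}" and y: "y \<in> {0..1}"
    unfolding x_def y_def using l' by (intro cell_vertex_in_cube i; simp)+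
  show "x \<le> y"
    using i \<delta> by (auto simp: x_def y_def less_eq_vec_def cell_vertex_def intro!: node_mono)
  moreover have "y \<le> Y"
    using cell_vertex_bounds(2)[OF i l'(2)] by (simp add: y_def Y_def less_eq_vec_def)
  ultimately have "vol0 y - vol0 x \<le> (\<Sum>j\<in>UNIV. (\<Prod>k\<in>UNIV - {j}. Y $ k) * (y $ j - x $ j))"
    using x by (intro vol0_diff_le_sum_cofactors) auto
  also have "\<dots> \<le> (\<Sum>j\<in>(UNIV :: 'n set). \<delta> / real CARD('n))"
  proof (intro sum_mono)
    fix j
    have "(1 - \<delta>) / real m * cofactor \<delta> m i j * real CARD('n) \<le> \<delta> * real (pieces \<delta> m i j)"
      using mult_left_mono[OF pieces_bounds(2)[of i j], of \<delta>] \<delta>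
      by (simp add: pieces_per_cofactor_def mult_ac)
    then have "(1 - \<delta>) / real m * cofactor \<delta> m i j / real (pieces \<delta> m i j) \<le> \<delta> / real CARD('n)"
      using pieces_bounds(1)[of i j] by (simp only: pos_divide_le_eq pos_le_divide_eq
          times_divide_eq_left of_nat_0_less_iff zero_less_card_finite)
    moreover have "y $ j - x $ j = (1 - \<delta>) / real m / real (pieces \<delta> m i j)"
      by (simp add: x_def y_def cell_vertex_def node_Suc)
    ultimately show "(\<Prod>k\<in>UNIV - {j}. Y $ k) * (y $ j - x $ j) \<le> \<delta> / real CARD('n)"
      by (simp add: Y_def mult_ac flip: cofactor_def)
  qed
  also have "\<dots> = \<delta>"
    by simp
  finally show "vol0 y - vol0 x \<le> \<delta>" .
qed

lemma cells_cover:
  fixes z :: "real ^ 'n::finite"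
  assumes "\<And>j. \<delta> \<le> z $ j" "\<And>j. z $ j \<le> 1"
  obtains i l where "i \<in> blocks m" "\<And>j. l j < pieces \<delta> m i j"
    "cell_vertex \<delta> m i l \<le> z" "z \<le> cell_vertex \<delta> m i (\<lambda>j. Suc (l j))"
proof -
  have "\<exists>i<m. node \<delta> 1 m i \<le> z $ j \<and> z $ j \<le> node \<delta> 1 m (Suc i)" for j
    using between_nodes[OF m assms] by metis
  then obtain i where i: "\<And>j. i j < m"
    "\<And>j. node \<delta> 1 m (i j) \<le> z $ j" "\<And>j. z $ j \<le> node \<delta> 1 m (Suc (i j))"
    by metis
  have "\<exists>l<pieces \<delta> m i j.
      node (node \<delta> 1 m (i j)) (node \<delta> 1 m (Suc (i j))) (pieces \<delta> m i j) l \<le> z $ j \<and>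
      z $ j \<le> node (node \<delta> 1 m (i j)) (node \<delta> 1 m (Suc (i j))) (pieces \<delta> m i j) (Suc l)" for j
    using between_nodes[OF pieces_bounds(1) i(2,3)] by metis
  then obtain l where "\<And>j. l j < pieces \<delta> m i j"
    "\<And>j. node (node \<delta> 1 m (i j)) (node \<delta> 1 m (Suc (i j))) (pieces \<delta> m i j) (l j) \<le> z $ j"
    "\<And>j. z $ j \<le> node (node \<delta> 1 m (i j)) (node \<delta> 1 m (Suc (i j))) (pieces \<delta> m i j) (Suc (l j))"
    by metis
  then show thesis
    using i(1) by (intro that[of i l]) (auto simp: mem_blocks less_eq_vec_def cell_vertex_def)
qed

end

section \<open>Covers from the graded grid and their cardinalities\<close>

text \<open>A point with some coordinate at most \<open>\<delta>\<close> lies in one of \<open>d\<close> slabs.  The top vertex of such a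
  slab has volume \<open>\<delta>\<close>, so that the slab is a \<open>\<delta>\<close>-bracket with lower vertex \<open>0\<close>.\<close>

definition face_vertex :: "real \<Rightarrow> 'n::finite \<Rightarrow> real ^ 'n" where
  "face_vertex \<delta> j = (\<chi> k. if k = j then \<delta> else 1)"

lemma face_vertex_in_cube: "0 < \<delta> \<Longrightarrow> \<delta> < 1 \<Longrightarrow> face_vertex \<delta> j \<in> {0..1}"
  by (auto simp: face_vertex_def less_eq_vec_def)

lemma vol0_face_vertex: "vol0 (face_vertex \<delta> j) = \<delta>"
  by (simp add: vol0_def face_vertex_def)

lemma vol0_zero [simp]: "vol0 0 = 0"
  by (simp add: vol0_def)

lemma le_face_vertex:
  "z $ j \<le> \<delta> \<Longrightarrow> z \<le> 1 \<Longrightarrow> z \<le> face_vertex \<delta> j"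
  by (auto simp: face_vertex_def less_eq_vec_def)

text \<open>The top vertices of the slabs already belong to the grid; hence the
  \<open>\<delta>\<close>-cover needs no additional points for the slabs, whereas the bracketing cover needs \<open>d\<close> brackets.\<close>

lemma face_vertex_is_cell_vertex:
  fixes j :: "'n::finite"
  assumes \<delta>: "0 < \<delta>" "\<delta> < 1" and m: "m > 0"
  obtains i l where "i \<in> blocks m" "\<And>k. l k \<le> pieces \<delta> m i k" "face_vertex \<delta> j = cell_vertex \<delta> m i l"
proof -
  \<comment> \<open>the block at the bottom in direction \<open>j\<close> and at the top in all other directions\<close>
  define i where "i k = (if k = j then 0 else m - 1)" for k
  define l where "l k = (if k = j then 0 else pieces \<delta> m i k)" for k
  have "pieces \<delta> m i k > 0" for k
    by (rule pieces_bounds(1)[OF \<delta> m])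
  then have "face_vertex \<delta> j = cell_vertex \<delta> m i l"
    using m by (auto simp: vec_eq_iff face_vertex_def cell_vertex_def l_def i_def)
  then show thesis
    using m by (intro that[of i l]) (auto simp: mem_blocks i_def l_def)
qed

text \<open>The cover consists of all cells together with the slabs along the lower faces; the
  slabs account for the summand \<open>d\<close>.\<close>

lemma bracketing_number_le_power:
  fixes d :: nat
  assumes d: "d = CARD('n::finite)" "d \<ge> 2" and \<delta>: "0 < \<delta>" "\<delta> < 1" and m: "m > 0"
  shows "ereal_of_enat (bracketing_number TYPE('n) \<delta>) \<le> ereal (real d +
     (\<Sum>l<m. 1 + pieces_per_cofactor d \<delta> m * node \<delta> 1 m (Suc l) ^ (d - 1)) ^ d)"
proof -
  define L where "L i = PiE UNIV (\<lambda>j. {..<pieces \<delta> m i j})" for i :: "'n \<Rightarrow> nat"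
  have mem_L: "l \<in> L i \<longleftrightarrow> (\<forall>j. l j < pieces \<delta> m i j)" for l i
    by (auto simp: L_def)
  define cell where "cell i l = {cell_vertex \<delta> m i l .. cell_vertex \<delta> m i (\<lambda>j. Suc (l j))}"
    for i l :: "'n \<Rightarrow> nat"
  define slabs :: "(real ^ 'n) set set" where "slabs = range (\<lambda>j. {0..face_vertex \<delta> j})"
  define cells where "cells = (\<Union>i\<in>blocks m. cell i ` L i)"
  have "is_bracketing_cover \<delta> (slabs \<union> cells)"
    unfolding is_bracketing_cover_def
  proof (intro conjI ballI)
    show "finite (slabs \<union> cells)"
      by (auto simp: slabs_def cells_def L_def intro!: finite_PiE)
    show brackets: "is_bracket \<delta> B" if "B \<in> slabs \<union> cells" for B
      using that
    proof
      assume "B \<in> slabs"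
      then obtain j where "B = {0..face_vertex \<delta> j}"
        by (auto simp: slabs_def)
      then show ?thesis
        using face_vertex_in_cube[OF \<delta>, of j] unfolding is_bracket_def
        by (intro bexI[of _ 0] bexI[of _ "face_vertex \<delta> j"])
           (auto simp: vol0_face_vertex less_eq_vec_def)
    next
      assume "B \<in> cells"
      then obtain i l where "i \<in> blocks m" "l \<in> L i" "B = cell i l"
        by (auto simp: cells_def)
      then show ?thesis
        using cell_is_bracket[OF \<delta> m, of i l] unfolding is_bracket_def cell_def mem_L by blast
    qed
    show "\<Union>(slabs \<union> cells) = {0..1}"
    proof (intro subset_antisym subsetI)
      fix z assume "z \<in> \<Union>(slabs \<union> cells)"
      then obtain B where "B \<in> slabs \<union> cells" "z \<in> B" by blast
      with brackets[of B] show "z \<in> {0..1}"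
        unfolding is_bracket_def by (auto intro: order_trans)
    next
      fix z :: "real ^ 'n" assume z: "z \<in> {0..1}"
      show "z \<in> \<Union>(slabs \<union> cells)"
      proof (cases "\<exists>j. z $ j \<le> \<delta>")
        case True
        then obtain j where "z $ j \<le> \<delta>" by blast
        with z have "z \<in> {0..face_vertex \<delta> j}"
          by (auto intro: le_face_vertex)
        then show ?thesis
          by (auto simp: slabs_def)
      next
        case False
        with z have "\<And>j. \<delta> \<le> z $ j" "\<And>j. z $ j \<le> 1"
          by (auto simp: less_eq_vec_def not_le less_imp_le)
        then obtain i l where "i \<in> blocks m" "\<And>j. l j < pieces \<delta> m i j" "z \<in> cell i l"
          unfolding cell_def atLeastAtMost_iff using cells_cover[OF \<delta> m] by metis
        then show ?thesis
          by (auto simp: cells_def mem_L)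
      qed
    qed
  qed
  then have "bracketing_number TYPE('n) \<delta> \<le> enat (card (slabs \<union> cells))"
    unfolding bracketing_number_def by (intro INF_lower) auto
  then have "ereal_of_enat (bracketing_number TYPE('n) \<delta>) \<le> ereal (real (card (slabs \<union> cells)))"
    by (metis ereal_of_enat_le_iff ereal_of_enat_simps(1))
  also have "card (slabs \<union> cells) \<le> d + (\<Sum>i\<in>blocks m. \<Prod>j\<in>(UNIV :: 'n set). pieces \<delta> m i j)"
  proof -
    have "card slabs \<le> d"
      unfolding slabs_def d(1) by (rule card_image_le) simp
    moreover have "card cells \<le> (\<Sum>i\<in>blocks m. card (cell i ` L i))"
      unfolding cells_def by (rule card_UN_le) simp
    moreover have "\<dots> \<le> (\<Sum>i\<in>blocks m. card (L i))"
      by (intro sum_mono card_image_le) (simp add: L_def finite_PiE)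
    ultimately show ?thesis
      using card_Un_le[of slabs cells] by (simp add: L_def card_PiE)
  qed
  also have "real (d + (\<Sum>i\<in>blocks m. \<Prod>j\<in>(UNIV :: 'n set). pieces \<delta> m i j))
      \<le> real d + (\<Sum>i\<in>blocks m. \<Prod>j\<in>(UNIV :: 'n set). 1 + pieces_per_cofactor d \<delta> m * cofactor \<delta> m i j)"
    unfolding d(1) of_nat_add of_nat_sum of_nat_prod
    by (intro add_left_mono sum_mono prod_mono conjI pieces_bounds \<delta> m) auto
  also have "\<dots> \<le> real d +
      (\<Sum>l<m. 1 + pieces_per_cofactor d \<delta> m * node \<delta> 1 m (Suc l) ^ (d - 1)) ^ d"
    by (intro add_left_mono sum_blocks_le_power d \<delta> pieces_per_cofactor_nonneg m) auto
  finally show ?thesis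
    by simp
qed

text \<open>The cover consists of all vertices of all cells.  A side divided into \<open>p\<close> pieces carries \<open>p + 1\<close>
  vertices, which turns the \<open>1\<close> of the bracketing bound, due to rounding up, into a \<open>2\<close>.\<close>

lemma covering_number_le_power:
  fixes d :: nat
  assumes d: "d = CARD('n::finite)" "d \<ge> 2" and \<delta>: "0 < \<delta>" "\<delta> < 1" and m: "m > 0"
  shows "ereal_of_enat (covering_number TYPE('n) \<delta>) \<le> ereal (
     (\<Sum>l<m. 2 + pieces_per_cofactor d \<delta> m * node \<delta> 1 m (Suc l) ^ (d - 1)) ^ d)"
proof -
  define L where "L i = PiE UNIV (\<lambda>j. {..pieces \<delta> m i j})" for i :: "'n \<Rightarrow> nat"
  have mem_L: "l \<in> L i \<longleftrightarrow> (\<forall>j. l j \<le> pieces \<delta> m i j)" for l i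
    by (auto simp: L_def)
  define \<Gamma> where "\<Gamma> = (\<Union>i\<in>blocks m. cell_vertex \<delta> m i ` L i)"
  have \<Gamma>I: "cell_vertex \<delta> m i l \<in> \<Gamma>" if "i \<in> blocks m" "\<And>j. l j \<le> pieces \<delta> m i j" for i l
    unfolding \<Gamma>_def by (rule UN_I[OF that(1)], rule imageI) (use that(2) in \<open>simp add: mem_L\<close>)
  have "is_delta_cover \<delta> \<Gamma>"
    unfolding is_delta_cover_def
  proof (intro conjI ballI)
    show "finite \<Gamma>"
      by (auto simp: \<Gamma>_def L_def intro!: finite_PiE)
    show "\<Gamma> \<subseteq> {0..1}"
      unfolding \<Gamma>_def
      by (intro UN_least image_subsetI cell_vertex_in_cube[OF \<delta> m]) (auto simp: mem_L)
    fix z :: "real ^ 'n" assume z: "z \<in> {0..1}"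
    show "\<exists>x\<in>\<Gamma> \<union> {0}. \<exists>y\<in>\<Gamma> \<union> {0}. x \<le> z \<and> z \<le> y \<and> vol0 y - vol0 x \<le> \<delta>"
    proof (cases "\<exists>j. z $ j \<le> \<delta>")
      case True
      then obtain j where j: "z $ j \<le> \<delta>" by blast
      have "face_vertex \<delta> j \<in> \<Gamma>"
        using face_vertex_is_cell_vertex[OF \<delta> m, of j] \<Gamma>I by metis
      with j z show ?thesis
        by (intro bexI[of _ 0] bexI[of _ "face_vertex \<delta> j"])
           (auto intro: le_face_vertex simp: vol0_face_vertex)
    next
      case False
      with z have "\<And>j. \<delta> \<le> z $ j" "\<And>j. z $ j \<le> 1"
        by (auto simp: less_eq_vec_def not_le less_imp_le)
      then obtain i l where il: "i \<in> blocks m" "\<And>j. l j < pieces \<delta> m i j"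
        "cell_vertex \<delta> m i l \<le> z" "z \<le> cell_vertex \<delta> m i (\<lambda>j. Suc (l j))"
        using cells_cover[OF \<delta> m] by metis
      then show ?thesis
        using cell_is_bracket(4)[OF \<delta> m il(1,2)]
        by (intro bexI[of _ "cell_vertex \<delta> m i l"]
            bexI[of _ "cell_vertex \<delta> m i (\<lambda>j. Suc (l j))"] conjI UnI1 \<Gamma>I)
           (auto simp: Suc_le_eq less_imp_le)
    qed
  qed
  then have "covering_number TYPE('n) \<delta> \<le> enat (card \<Gamma>)"
    unfolding covering_number_def by (intro INF_lower) auto
  then have "ereal_of_enat (covering_number TYPE('n) \<delta>) \<le> ereal (real (card \<Gamma>))"
    by (metis ereal_of_enat_le_iff ereal_of_enat_simps(1))
  also have "card \<Gamma> \<le> (\<Sum>i\<in>blocks m. \<Prod>j\<in>(UNIV :: 'n set). Suc (pieces \<delta> m i j))"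
  proof -
    have "card \<Gamma> \<le> (\<Sum>i\<in>blocks m. card (cell_vertex \<delta> m i ` L i))"
      unfolding \<Gamma>_def by (rule card_UN_le) simp
    also have "\<dots> \<le> (\<Sum>i\<in>blocks m. card (L i))"
      by (intro sum_mono card_image_le) (simp add: L_def finite_PiE)
    finally show ?thesis
      by (simp add: L_def card_PiE)
  qed
  also have "real (\<Sum>i\<in>blocks m. \<Prod>j\<in>(UNIV :: 'n set). Suc (pieces \<delta> m i j))
      \<le> (\<Sum>i\<in>blocks m. \<Prod>j\<in>(UNIV :: 'n set). 2 + pieces_per_cofactor d \<delta> m * cofactor \<delta> m i j)"
    unfolding d(1) of_nat_sum of_nat_prod
  proof (intro sum_mono prod_mono conjI)
    show "real (Suc (pieces \<delta> m i j)) \<le> 2 + pieces_per_cofactor CARD('n) \<delta> m * cofactor \<delta> m i j"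
      for i :: "'n \<Rightarrow> nat" and j
      using pieces_bounds(3)[OF \<delta> m, of i j] by simp
  qed auto
  also have "\<dots> \<le> (\<Sum>l<m. 2 + pieces_per_cofactor d \<delta> m * node \<delta> 1 m (Suc l) ^ (d - 1)) ^ d"
    by (intro sum_blocks_le_power d \<delta> pieces_per_cofactor_nonneg m) auto
  finally show ?thesis
    by simp
qed

section \<open>Choosing the number of intervals\<close>

lemma A_coeff_bounds:
  assumes "0 < \<delta>" "\<delta> < 1" "d \<ge> 2"
  shows "0 < A_coeff d \<delta>" "A_coeff d \<delta> \<le> real d"
proof -
  have p: "0 < \<delta> ^ (d - 1)" "\<delta> ^ (d - 1) < 1"
    using assms by (auto simp: power_less_one_iff)
  show "0 < A_coeff d \<delta>"
    using assms p by (simp add: A_coeff_def)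
  have "(1 - \<delta>) * (1 - \<delta> ^ (d - 1)) \<le> 1 * 1"
    using assms p by (intro mult_mono) auto
  then show "A_coeff d \<delta> \<le> real d"
    using mult_left_mono[of "(1 - \<delta>) * (1 - \<delta> ^ (d - 1))" 1 "real d"]
    by (simp add: A_coeff_def mult.assoc)
qed

lemma R_coeff_bounds:
  assumes "0 < \<delta>" "\<delta> < 1" "d \<ge> 2"
  shows "0 \<le> R_coeff d \<delta>" "R_coeff d \<delta> \<le> (real d - 1) / 6"
proof -
  have p: "\<delta> ^ (d - 1) < 1"
    using assms by (auto simp: power_less_one_iff)
  have q: "\<delta> ^ (d - 1) \<le> \<delta> ^ (d - 2)" "\<delta> ^ (d - 2) \<le> 1"
    using assms by (auto intro!: power_decreasing power_le_one)
  show "0 \<le> R_coeff d \<delta>"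
    using assms p q by (simp add: R_coeff_def)
  have "(1 - \<delta>) * (1 - \<delta> ^ (d - 2)) \<le> 1 * (1 - \<delta> ^ (d - 1))"
    using assms q by (intro mult_mono) auto
  then have "(1 - \<delta>) * (1 - \<delta> ^ (d - 2)) / (1 - \<delta> ^ (d - 1)) \<le> 1"
    using p by (simp add: field_simps)
  then show "R_coeff d \<delta> \<le> (real d - 1) / 6"
    using assms mult_left_mono[of "(1 - \<delta>) * (1 - \<delta> ^ (d - 2)) / (1 - \<delta> ^ (d - 1))" 1 "(real d - 1) / 6"]
    by (simp add: R_coeff_def)
qed

text \<open>A right endpoint Riemann sum of \<open>d * x ^ (d - 1)\<close> over \<open>[\<delta>, 1]\<close>, whose integral is \<open>1 - \<delta> ^ d\<close>.
  This is where \<open>A_coeff\<close> and \<open>R_coeff\<close> come from: \<open>A_coeff d \<delta>\<close> is the increment of the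
  integrand times \<open>1 - \<delta>\<close>, and \<open>A_coeff d \<delta> * R_coeff d \<delta>\<close> is the increment of its derivative times
  \<open>(1 - \<delta>)\<^sup>2 / 6\<close>.\<close>

lemma sum_powers_at_nodes_le:
  assumes \<delta>: "0 < \<delta>" "\<delta> < 1" and d: "d \<ge> 2" and m: "m > 0"
  shows "(\<Sum>l<m. (1 - \<delta>) / real m * real d * node \<delta> 1 m (Suc l) ^ (d - 1))
     \<le> 1 - \<delta> ^ d + A_coeff d \<delta> / (2 * real m) + A_coeff d \<delta> * R_coeff d \<delta> / (2 * (real m)\<^sup>2)"
proof -
  define h where "h = (1 - \<delta>) / real m"
  define g where "g l = node \<delta> 1 m l ^ d + h / 2 * real d * node \<delta> 1 m l ^ (d - 1)
      + h\<^sup>2 / 12 * real d * (real d - 1) * node \<delta> 1 m l ^ (d - 2)" for l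
  define q where "q = 1 - \<delta> ^ (d - 1)"
  have "q > 0"
    using assms by (auto simp: q_def power_less_one_iff)
  then have AR: "A_coeff d \<delta> * R_coeff d \<delta>
      = real d * (1 - \<delta>) * ((real d - 1) / 6 * ((1 - \<delta>) * (1 - \<delta> ^ (d - 2))))"
    unfolding A_coeff_def R_coeff_def q_def[symmetric] by simp
  have "(\<Sum>l<m. h * real d * node \<delta> 1 m (Suc l) ^ (d - 1)) \<le> (\<Sum>l<m. g (Suc l) - g l)"
  proof (intro sum_mono)
    fix l
    have "node \<delta> 1 m l \<ge> 0" "h \<ge> 0"
      using \<delta> by (simp_all add: node_def h_def)
    from right_endpoint_rule_power[OF this d]
    show "h * real d * node \<delta> 1 m (Suc l) ^ (d - 1) \<le> g (Suc l) - g l"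
      by (simp add: g_def node_Suc h_def[symmetric] right_diff_distrib)
  qed
  also have "\<dots> = g m - g 0"
    by (rule sum_lessThan_telescope)
  also have "\<dots> = 1 - \<delta> ^ d + h / 2 * real d * (1 - \<delta> ^ (d - 1))
      + h\<^sup>2 / 12 * real d * (real d - 1) * (1 - \<delta> ^ (d - 2))"
    using m by (simp add: g_def right_diff_distrib)
  also have "h / 2 * real d * (1 - \<delta> ^ (d - 1)) = A_coeff d \<delta> / (2 * real m)"
    by (simp add: h_def A_coeff_def mult_ac)
  also have "h\<^sup>2 / 12 * real d * (real d - 1) * (1 - \<delta> ^ (d - 2))
      = A_coeff d \<delta> * R_coeff d \<delta> / (2 * (real m)\<^sup>2)"
    unfolding AR by (simp add: h_def power_divide power2_eq_square mult_ac)
  finally show ?thesis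
    by (simp add: h_def)
qed

text \<open>\<open>piece_total d w \<delta> / \<delta>\<close> is the quantity whose \<open>d\<close>-th power appears in the bounds: \<open>w = 1\<close> gives the
  bracketing bound and \<open>w = 2\<close> the covering bound.\<close>

definition piece_total :: "nat \<Rightarrow> real \<Rightarrow> real \<Rightarrow> real" where
  "piece_total d w \<delta> =
     1 - \<delta> ^ d + sqrt (2 * w * A_coeff d \<delta> * \<delta>) + w * \<delta> * (1 + R_coeff d \<delta>)"

text \<open>Apart from the second order term of the Riemann sum, \<open>\<delta>\<close> times the sum to be bounded exceeds
  \<open>1 - \<delta> ^ d\<close> by at most \<open>A / (2 * m) + w * \<delta> * m\<close>, the discretization error plus the cost of rounding
  the numbers of pieces.  For real \<open>m\<close> the minimum is attained at \<open>s = sqrt (A / (2 * w * \<delta>))\<close>, where both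
  terms are equal.  Rounding \<open>s\<close> up to an integer costs at most one more \<open>w * \<delta>\<close>, and the second
  order term is then at most \<open>w * \<delta> * R\<close>.\<close>

lemma optimal_mesh:
  assumes \<delta>: "0 < \<delta>" "\<delta> < 1" and d: "d \<ge> 2" and w: "w > 0"
  obtains m where "m > 0"
    "(\<Sum>l<m. w + pieces_per_cofactor d \<delta> m * node \<delta> 1 m (Suc l) ^ (d - 1)) \<le> piece_total d w \<delta> / \<delta>"
proof -
  define A where "A = A_coeff d \<delta>"
  define R where "R = R_coeff d \<delta>"
  define s where "s = sqrt (A / (2 * w * \<delta>))"
  define m where "m = nat \<lceil>s\<rceil>"
  have A: "A > 0" and R: "R \<ge> 0"
    using A_coeff_bounds(1) R_coeff_bounds(1) \<delta> d by (simp_all add: A_def R_def)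
  have s: "s > 0"
    using A w \<delta> by (simp add: s_def)
  have m: "m > 0" "s \<le> real m" "real m \<le> s + 1"
    using s unfolding m_def by linarith+
  have As: "A = 2 * w * \<delta> * s\<^sup>2"
    using A w \<delta> by (simp add: s_def)
  have "sqrt (2 * w * A * \<delta>) = sqrt ((2 * w * \<delta> * s)\<^sup>2)"
    by (rule arg_cong[where f = sqrt]) (simp add: As power2_eq_square)
  then have root: "sqrt (2 * w * A * \<delta>) = 2 * w * \<delta> * s"
    using w \<delta> s by simp
  have "A / (2 * real m) \<le> A / (2 * s)"
    using A s m by (intro divide_left_mono) auto
  also have "A / (2 * s) = w * \<delta> * s"
    using s by (simp add: As power2_eq_square)
  finally have 1: "A / (2 * real m) \<le> w * \<delta> * s" .
  have "A * R / (2 * (real m)\<^sup>2) \<le> A * R / (2 * s\<^sup>2)"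
    using A R s m by (intro divide_left_mono mult_left_mono power_mono) auto
  also have "\<dots> = w * \<delta> * R"
    using s by (simp add: As)
  finally have 2: "A * R / (2 * (real m)\<^sup>2) \<le> w * \<delta> * R" .
  have 3: "w * \<delta> * real m \<le> w * \<delta> * (s + 1)"
    using m w \<delta> by (intro mult_left_mono) auto
  have "\<delta> * (\<Sum>l<m. w + pieces_per_cofactor d \<delta> m * node \<delta> 1 m (Suc l) ^ (d - 1))
      = (\<Sum>l<m. w * \<delta> + \<delta> * pieces_per_cofactor d \<delta> m * node \<delta> 1 m (Suc l) ^ (d - 1))"
    by (simp add: sum_distrib_left algebra_simps)
  also have "\<dots> = w * \<delta> * real m + (\<Sum>l<m. (1 - \<delta>) / real m * real d * node \<delta> 1 m (Suc l) ^ (d - 1))"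
    using \<delta> by (simp add: sum.distrib pieces_per_cofactor_def mult_ac)
  also have "\<dots> \<le> piece_total d w \<delta>"
    using 1 2 3 root sum_powers_at_nodes_le[OF \<delta> d m(1)]
    by (simp add: piece_total_def distrib_left flip: A_def R_def)
  finally show thesis
    using \<delta> m by (intro that[of m]) (auto simp: field_simps)
qed

lemma bracketing_bound_eq:
  "bracketing_bound d \<delta> = real d + \<delta> powi (- int d) * piece_total d 1 \<delta> ^ d"
  by (simp add: bracketing_bound_def piece_total_def)

lemma covering_bound_eq: "covering_bound d \<delta> = \<delta> powi (- int d) * piece_total d 2 \<delta> ^ d"
proof -
  have "sqrt (2 * 2 * A_coeff d \<delta> * \<delta>) = sqrt (2\<^sup>2 * (A_coeff d \<delta> * \<delta>))"
    by (simp add: power2_eq_square mult_ac)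
  also have "\<dots> = 2 * sqrt (A_coeff d \<delta> * \<delta>)"
    unfolding real_sqrt_mult by simp
  finally show ?thesis
    by (simp add: covering_bound_def piece_total_def)
qed

lemma powi_minus_mult_power: "\<delta> powi (- int d) * a ^ d = (a / \<delta>) ^ d" for \<delta> a :: real
  by (simp add: power_int_minus power_divide field_simps)

lemma bracketing_number_le_bound:
  assumes "d = CARD('n::finite)" "d \<ge> 2" "0 < \<delta>" "\<delta> < 1"
  shows "ereal_of_enat (bracketing_number TYPE('n) \<delta>) \<le> ereal (bracketing_bound d \<delta>)"
proof -
  obtain m where m: "m > 0"
    "(\<Sum>l<m. 1 + pieces_per_cofactor d \<delta> m * node \<delta> 1 m (Suc l) ^ (d - 1)) \<le> piece_total d 1 \<delta> / \<delta>"
    using optimal_mesh[of \<delta> d 1] assms by auto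
  note bracketing_number_le_power[OF assms m(1)]
  also have "ereal (real d + (\<Sum>l<m. 1 + pieces_per_cofactor d \<delta> m * node \<delta> 1 m (Suc l) ^ (d - 1)) ^ d)
      \<le> ereal (bracketing_bound d \<delta>)"
    using assms unfolding bracketing_bound_eq powi_minus_mult_power ereal_less_eq
    by (intro add_left_mono power_mono m sum_nonneg add_nonneg_nonneg mult_nonneg_nonneg
        pieces_per_cofactor_nonneg zero_le_power) (auto simp: node_def m)
  finally show ?thesis .
qed

lemma covering_number_le_bound:
  assumes "d = CARD('n::finite)" "d \<ge> 2" "0 < \<delta>" "\<delta> < 1"
  shows "ereal_of_enat (covering_number TYPE('n) \<delta>) \<le> ereal (covering_bound d \<delta>)"
proof -
  obtain m where m: "m > 0"
    "(\<Sum>l<m. 2 + pieces_per_cofactor d \<delta> m * node \<delta> 1 m (Suc l) ^ (d - 1)) \<le> piece_total d 2 \<delta> / \<delta>"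
    using optimal_mesh[of \<delta> d 2] assms by auto
  note covering_number_le_power[OF assms m(1)]
  also have "ereal ((\<Sum>l<m. 2 + pieces_per_cofactor d \<delta> m * node \<delta> 1 m (Suc l) ^ (d - 1)) ^ d)
      \<le> ereal (covering_bound d \<delta>)"
    using assms unfolding covering_bound_eq powi_minus_mult_power ereal_less_eq
    by (intro power_mono m sum_nonneg add_nonneg_nonneg mult_nonneg_nonneg
        pieces_per_cofactor_nonneg zero_le_power) (auto simp: node_def m)
  finally show ?thesis .
qed

section \<open>Asymptotics and the main theorem\<close>

lemma power_le_sqrt:
  assumes "0 < \<delta>" "\<delta> < 1" "d > 0"
  shows "\<delta> ^ d \<le> sqrt \<delta>"
proof -
  have "\<delta> ^ d \<le> \<delta> ^ 1"
    using assms by (intro power_decreasing) auto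
  also have "\<delta> ^ 1 \<le> sqrt \<delta>"
    using assms by (intro real_le_rsqrt) (simp add: power2_eq_square mult_left_le)
  finally show ?thesis .
qed

lemma piece_total_bigo:
  assumes d: "d \<ge> 2" and w: "w > 0"
  shows "(\<lambda>\<delta>. piece_total d w \<delta> - 1) \<in> O[at_right 0](\<lambda>\<delta>. sqrt \<delta>)"
proof (rule bigoI)
  define C where "C = 1 + sqrt (2 * w * real d) + w * (1 + (real d - 1) / 6)"
  have "\<bar>piece_total d w \<delta> - 1\<bar> \<le> C * sqrt \<delta>" if \<delta>: "0 < \<delta>" "\<delta> < 1" for \<delta>
  proof -
    note A = A_coeff_bounds[OF \<delta> d] and R = R_coeff_bounds[OF \<delta> d]
    have 1: "0 \<le> \<delta> ^ d" "\<delta> ^ d \<le> sqrt \<delta>"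
      using power_le_sqrt[OF \<delta>, of d] d \<delta> by auto
    have 2: "0 \<le> sqrt (2 * w * A_coeff d \<delta> * \<delta>)"
      using A w \<delta> by simp
    have 3: "sqrt (2 * w * A_coeff d \<delta> * \<delta>) \<le> sqrt (2 * w * real d) * sqrt \<delta>"
      unfolding real_sqrt_mult[symmetric] using A w \<delta>
      by (intro real_sqrt_le_mono mult_right_mono mult_left_mono) auto
    have 4: "0 \<le> w * \<delta> * (1 + R_coeff d \<delta>)"
      using R w \<delta> by simp
    have "w * (1 + R_coeff d \<delta>) * \<delta> \<le> w * (1 + (real d - 1) / 6) * sqrt \<delta>"
      using R w \<delta> d power_le_sqrt[OF \<delta>, of 1] by (intro mult_mono) auto
    then have 5: "w * \<delta> * (1 + R_coeff d \<delta>) \<le> w * (1 + (real d - 1) / 6) * sqrt \<delta>"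
      by (simp only: mult_ac)
    have "C * sqrt \<delta> = sqrt \<delta> + sqrt (2 * w * real d) * sqrt \<delta>
        + w * (1 + (real d - 1) / 6) * sqrt \<delta>"
      by (simp add: C_def distrib_right)
    with 1 2 3 4 5 show ?thesis
      unfolding piece_total_def by linarith
  qed
  moreover have "eventually (\<lambda>\<delta>::real. \<delta> \<in> {0<..<1}) (at_right 0)"
    by (rule eventually_at_right_real) simp
  ultimately show "eventually (\<lambda>\<delta>. norm (piece_total d w \<delta> - 1) \<le> C * norm (sqrt \<delta>)) (at_right 0)"
    by (auto elim!: eventually_mono)
qed

lemma piece_total_power_bigo:
  assumes d: "d \<ge> 2" and w: "w > 0"
  shows "(\<lambda>\<delta>. piece_total d w \<delta> ^ d - 1) \<in> O[at_right 0](\<lambda>\<delta>. sqrt \<delta>)"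
proof -
  have sqrt: "(\<lambda>\<delta>. sqrt \<delta>) \<in> O[at_right 0](\<lambda>_. 1)"
  proof (rule bigoI)
    have "eventually (\<lambda>\<delta>::real. \<delta> \<in> {0<..<1}) (at_right 0)"
      by (rule eventually_at_right_real) simp
    then show "eventually (\<lambda>\<delta>::real. norm (sqrt \<delta>) \<le> 1 * norm (1 :: real)) (at_right 0)"
      by eventually_elim auto
  qed
  have "(\<lambda>\<delta>. (piece_total d w \<delta> - 1) + 1) \<in> O[at_right 0](\<lambda>_. 1)"
    by (intro sum_in_bigo landau_o.big_trans[OF piece_total_bigo[OF assms] sqrt]) auto
  then have "piece_total d w \<in> O[at_right 0](\<lambda>_. 1)"
    by simp
  then have "(\<lambda>\<delta>. piece_total d w \<delta> ^ k) \<in> O[at_right 0](\<lambda>_. 1 ^ k)" for k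
    by (rule landau_o.big_power)
  then have "(\<lambda>\<delta>. \<Sum>k<d. piece_total d w \<delta> ^ k) \<in> O[at_right 0](\<lambda>_. 1)"
    by (intro big_sum_in_bigo) simp
  from landau_o.big.mult[OF piece_total_bigo[OF assms] this] show ?thesis
    by (simp add: power_diff_1_eq)
qed

theorem corollary4p5:
  fixes d :: nat
  assumes "d = CARD('n::finite)" and "d \<ge> 2"
  shows
    "(\<forall>\<delta>::real. 0 < \<delta> \<and> \<delta> < 1 \<longrightarrow>
        ereal_of_enat (bracketing_number TYPE('n) \<delta>) \<le> ereal (bracketing_bound d \<delta>) \<and>
        ereal_of_enat (covering_number TYPE('n) \<delta>) \<le> ereal (covering_bound d \<delta>)) \<and>
     (\<exists>h \<in> O[at_right 0](\<lambda>\<delta>::real. sqrt \<delta>). \<forall>\<delta>. 0 < \<delta> \<and> \<delta> < 1 \<longrightarrow>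
        bracketing_bound d \<delta> = \<delta> powi (- int d) * (1 + h \<delta>)) \<and>
     (\<exists>h \<in> O[at_right 0](\<lambda>\<delta>::real. sqrt \<delta>). \<forall>\<delta>. 0 < \<delta> \<and> \<delta> < 1 \<longrightarrow>
        covering_bound d \<delta> = \<delta> powi (- int d) * (1 + h \<delta>))"
proof (intro conjI)
  show "\<forall>\<delta>::real. 0 < \<delta> \<and> \<delta> < 1 \<longrightarrow>
        ereal_of_enat (bracketing_number TYPE('n) \<delta>) \<le> ereal (bracketing_bound d \<delta>) \<and>
        ereal_of_enat (covering_number TYPE('n) \<delta>) \<le> ereal (covering_bound d \<delta>)"
    using bracketing_number_le_bound[OF assms] covering_number_le_bound[OF assms] by blast
  have power: "(\<lambda>\<delta>. \<delta> ^ d) \<in> O[at_right 0](\<lambda>\<delta>::real. sqrt \<delta>)"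
  proof (rule bigoI)
    have "eventually (\<lambda>\<delta>::real. \<delta> \<in> {0<..<1}) (at_right 0)"
      by (rule eventually_at_right_real) simp
    then show "eventually (\<lambda>\<delta>::real. norm (\<delta> ^ d) \<le> 1 * norm (sqrt \<delta>)) (at_right 0)"
      by eventually_elim (use power_le_sqrt[of _ d] assms(2) in auto)
  qed
  show "\<exists>h \<in> O[at_right 0](\<lambda>\<delta>::real. sqrt \<delta>). \<forall>\<delta>. 0 < \<delta> \<and> \<delta> < 1 \<longrightarrow>
        bracketing_bound d \<delta> = \<delta> powi (- int d) * (1 + h \<delta>)"
  proof (intro bexI allI impI)
    have "(\<lambda>\<delta>. real d * \<delta> ^ d) \<in> O[at_right 0](\<lambda>\<delta>::real. sqrt \<delta>)"
      using power by simp
    then show "(\<lambda>\<delta>. real d * \<delta> ^ d + (piece_total d 1 \<delta> ^ d - 1)) \<in> O[at_right 0](\<lambda>\<delta>::real. sqrt \<delta>)"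
      using piece_total_power_bigo[OF assms(2), of 1] by (rule sum_in_bigo(1)) simp
  qed (auto simp: bracketing_bound_eq power_int_minus field_simps)
  show "\<exists>h \<in> O[at_right 0](\<lambda>\<delta>::real. sqrt \<delta>). \<forall>\<delta>. 0 < \<delta> \<and> \<delta> < 1 \<longrightarrow>
        covering_bound d \<delta> = \<delta> powi (- int d) * (1 + h \<delta>)"
  proof (intro bexI allI impI)
    show "(\<lambda>\<delta>. piece_total d 2 \<delta> ^ d - 1) \<in> O[at_right 0](\<lambda>\<delta>::real. sqrt \<delta>)"
      using piece_total_power_bigo[OF assms(2), of 2] by simp
  qed (auto simp: covering_bound_eq)
qed

end
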